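(* Let $(\mathbb{R},r)$ be the terminal object of the category $\mathbf{NAS}_\bullet$ of pointed non-anomalous semigroups. Then every dense and complete totally ordered group is isomorphic to $\mathbb{R}$.
   Context: Here $\mathbb{R}$ is defined only as the totally ordered semigroup underlying the terminal object of $\mathbf{NAS}_\bullet$ (which exists and is unique up to isomorphism), not by a classical construction. A totally ordered semigroup is a set $S$ with a binary relation $<$ and an operation $+$ (not assumed commutative) such that for all $x,y,z\in S$: (1) $x<y$ and $y<z$ imply $x<z$; (2) exactly one of $x<y$, $x=y$, $x>y$ holds; (3) $(x+y)+z=x+(y+z)$; (4) $x<y$ implies $x+z<y+z$ and $z+x<z+y$. A totally ordered group is a totally ordered semigroup that is a group. $\mathbb{N}=\{1,2,3,\dots\}$ and $nx$ is the $n$-fold sum of $x$. Elements $x>y$ form an anomalous pair if either $nx<(n+1)y$ for every $n\in\mathbb{N}$, or $ny>(n+1)x$ for every $n\in\mathbb{N}$. A non-anomalous semigroup is a totally ordered semigroup with no anomalous pair. A positive (resp. negative) morphism between totally ordered semigroups is a map $f$ with $f(x+y)=f(x)+f(y)$ and $x<y\Rightarrow f(x)<f(y)$ (resp. $x<y\Rightarrow f(x)>f(y)$). A morphism is a positive or negative morphism. $\mathbf{NAS}_\bullet$ has as objects the pairs $(A,a)$ with $A$ a non-anomalous semigroup and $a\in A$ not an identity; arrows $(A,a)\to(B,b)$ are morphisms $f:A\to B$ with $f(a)=b$. An order is dense if for every $x>y$ there is $z$ with $x>z>y$. An order $A$ is complete if every nonempty subset $U\subseteq A$ that is bounded above (there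 is $a\in A$ with $u\le a$ for all $u\in U$) has a least upper bound in $A$. An isomorphism of totally ordered semigroups is a bijective positive morphism.
   Formalization: The totally ordered group is additionally assumed to have at least two elements, since the one-element group is vacuously dense and complete but is not isomorphic to ℝ. *)

theory Defs
  imports "HOL-Algebra.Group"
begin

record 'a ord_magma = "'a partial_object" +
  splus :: "'a \<Rightarrow> 'a \<Rightarrow> 'a" (infixl "\<boxplus>\<index>" 65)
  sless :: "'a \<Rightarrow> 'a \<Rightarrow> bool" (infix "\<prec>\<index>" 50)

text \<open>Only the behaviour of the operation and the relation on the carrier matters.
  As in the usual definition of a semigroup on a set, the carrier may be empty.\<close>

definition tot_ord_semigroup :: "'a ord_magma \<Rightarrow> bool" where
  "tot_ord_semigroup S \<longleftrightarrow>
    (\<forall>x\<in>carrier S. \<forall>y\<in>carrier S. x \<boxplus>\<^bsub>S\<^esub> y \<in> carrier S) \<and>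
    (\<forall>x\<in>carrier S. \<forall>y\<in>carrier S. \<forall>z\<in>carrier S.
        x \<prec>\<^bsub>S\<^esub> y \<longrightarrow> y \<prec>\<^bsub>S\<^esub> z \<longrightarrow> x \<prec>\<^bsub>S\<^esub> z) \<and>
    (\<forall>x\<in>carrier S. \<forall>y\<in>carrier S.
        (x \<prec>\<^bsub>S\<^esub> y \<and> x \<noteq> y \<and> \<not> y \<prec>\<^bsub>S\<^esub> x) \<or>
        (\<not> x \<prec>\<^bsub>S\<^esub> y \<and> x = y \<and> \<not> y \<prec>\<^bsub>S\<^esub> x) \<or>
        (\<not> x \<prec>\<^bsub>S\<^esub> y \<and> x \<noteq> y \<and> y \<prec>\<^bsub>S\<^esub> x)) \<and>
    (\<forall>x\<in>carrier S. \<forall>y\<in>carrier S. \<forall>z\<in>carrier S.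
        (x \<boxplus>\<^bsub>S\<^esub> y) \<boxplus>\<^bsub>S\<^esub> z = x \<boxplus>\<^bsub>S\<^esub> (y \<boxplus>\<^bsub>S\<^esub> z)) \<and>
    (\<forall>x\<in>carrier S. \<forall>y\<in>carrier S. \<forall>z\<in>carrier S.
        x \<prec>\<^bsub>S\<^esub> y \<longrightarrow>
        x \<boxplus>\<^bsub>S\<^esub> z \<prec>\<^bsub>S\<^esub> y \<boxplus>\<^bsub>S\<^esub> z \<and> z \<boxplus>\<^bsub>S\<^esub> x \<prec>\<^bsub>S\<^esub> z \<boxplus>\<^bsub>S\<^esub> y)"

definition tot_ord_group :: "'a ord_magma \<Rightarrow> bool" where
  "tot_ord_group S \<longleftrightarrow> tot_ord_semigroup S \<and>
    (\<exists>e. group \<lparr>carrier = carrier S, mult = splus S, one = e\<rparr>)"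

text \<open>The \<open>n\<close>-fold sum of \<open>x\<close>, meaningful only for \<open>n \<ge> 1\<close>: there need not be an
  identity to serve as the empty sum.\<close>

definition multiple :: "'a ord_magma \<Rightarrow> nat \<Rightarrow> 'a \<Rightarrow> 'a" where
  "multiple S n x = ((\<lambda>y. y \<boxplus>\<^bsub>S\<^esub> x) ^^ (n - 1)) x"

definition anomalous_pair :: "'a ord_magma \<Rightarrow> 'a \<Rightarrow> 'a \<Rightarrow> bool" where
  "anomalous_pair S x y \<longleftrightarrow> y \<prec>\<^bsub>S\<^esub> x \<and>
    ((\<forall>n\<ge>1. multiple S n x \<prec>\<^bsub>S\<^esub> multiple S (n + 1) y) \<or>
     (\<forall>n\<ge>1. multiple S (n + 1) x \<prec>\<^bsub>S\<^esub> multiple S n y))"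

definition nonanomalous_semigroup :: "'a ord_magma \<Rightarrow> bool" where
  "nonanomalous_semigroup S \<longleftrightarrow> tot_ord_semigroup S \<and>
    \<not> (\<exists>x\<in>carrier S. \<exists>y\<in>carrier S. anomalous_pair S x y)"

definition positive_morphism :: "'a ord_magma \<Rightarrow> 'b ord_magma \<Rightarrow> ('a \<Rightarrow> 'b) \<Rightarrow> bool" where
  "positive_morphism S T f \<longleftrightarrow> f \<in> carrier S \<rightarrow> carrier T \<and>
    (\<forall>x\<in>carrier S. \<forall>y\<in>carrier S. f (x \<boxplus>\<^bsub>S\<^esub> y) = f x \<boxplus>\<^bsub>T\<^esub> f y) \<and>
    (\<forall>x\<in>carrier S. \<forall>y\<in>carrier S. x \<prec>\<^bsub>S\<^esub> y \<longrightarrow> f x \<prec>\<^bsub>T\<^esub> f y)"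

definition negative_morphism :: "'a ord_magma \<Rightarrow> 'b ord_magma \<Rightarrow> ('a \<Rightarrow> 'b) \<Rightarrow> bool" where
  "negative_morphism S T f \<longleftrightarrow> f \<in> carrier S \<rightarrow> carrier T \<and>
    (\<forall>x\<in>carrier S. \<forall>y\<in>carrier S. f (x \<boxplus>\<^bsub>S\<^esub> y) = f x \<boxplus>\<^bsub>T\<^esub> f y) \<and>
    (\<forall>x\<in>carrier S. \<forall>y\<in>carrier S. x \<prec>\<^bsub>S\<^esub> y \<longrightarrow> f y \<prec>\<^bsub>T\<^esub> f x)"

definition tos_isomorphic :: "'a ord_magma \<Rightarrow> 'b ord_magma \<Rightarrow> bool" where
  "tos_isomorphic S T \<longleftrightarrow>
    (\<exists>f. positive_morphism S T f \<and> bij_betw f (carrier S) (carrier T))"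

definition is_identity :: "'a ord_magma \<Rightarrow> 'a \<Rightarrow> bool" where
  "is_identity S e \<longleftrightarrow> e \<in> carrier S \<and>
    (\<forall>x\<in>carrier S. e \<boxplus>\<^bsub>S\<^esub> x = x \<and> x \<boxplus>\<^bsub>S\<^esub> e = x)"

text \<open>The category of pointed non-anomalous semigroups whose carriers are subsets of the
  type \<open>'a\<close>, which plays the role of the universe. Arrows are extensional functions, so that
  equality of arrows is equality of functions on the carrier.\<close>

definition nas_obj :: "('a ord_magma \<times> 'a) set" where
  "nas_obj = {(A, a). nonanomalous_semigroup A \<and> a \<in> carrier A \<and> \<not> is_identity A a}"

definition nas_hom :: "'a ord_magma \<times> 'a \<Rightarrow> 'b ord_magma \<times> 'b \<Rightarrow> ('a \<Rightarrow> 'b) set" where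
  "nas_hom = (\<lambda>(A, a) (B, b). {f \<in> carrier A \<rightarrow>\<^sub>E carrier B.
     (positive_morphism A B f \<or> negative_morphism A B f) \<and> f a = b})"

definition nas_terminal :: "'a ord_magma \<times> 'a \<Rightarrow> bool" where
  "nas_terminal T \<longleftrightarrow> T \<in> nas_obj \<and>
    (\<forall>X::'a ord_magma \<times> 'a. X \<in> nas_obj \<longrightarrow> (\<exists>!f. f \<in> nas_hom X T))"

definition dense_order :: "'a ord_magma \<Rightarrow> bool" where
  "dense_order S \<longleftrightarrow> (\<forall>x\<in>carrier S. \<forall>y\<in>carrier S. y \<prec>\<^bsub>S\<^esub> x \<longrightarrow>
    (\<exists>z\<in>carrier S. z \<prec>\<^bsub>S\<^esub> x \<and> y \<prec>\<^bsub>S\<^esub> z))"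

definition is_upper_bound :: "'a ord_magma \<Rightarrow> 'a set \<Rightarrow> 'a \<Rightarrow> bool" where
  "is_upper_bound S U b \<longleftrightarrow> b \<in> carrier S \<and> (\<forall>u\<in>U. u \<prec>\<^bsub>S\<^esub> b \<or> u = b)"

definition complete_order :: "'a ord_magma \<Rightarrow> bool" where
  "complete_order S \<longleftrightarrow> (\<forall>U. U \<subseteq> carrier S \<and> U \<noteq> {} \<and> (\<exists>b. is_upper_bound S U b) \<longrightarrow>
    (\<exists>s. is_upper_bound S U s \<and> (\<forall>b. is_upper_bound S U b \<longrightarrow> s \<prec>\<^bsub>S\<^esub> b \<or> s = b)))"

end

theory Submission imports Defs Complex_Main "HOL-Library.Countable" begin

text \<open>
  The classical real line mediates: both \<open>R\<close> and \<open>G\<close> are carried onto it by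
  order-preserving isomorphisms, and the required isomorphism is the composite of one with
  the inverse of the other.

  Both halves rest on a theorem of Hoelder type (\<open>nonanomalous_embeds_in_reals\<close>): a
  non-anomalous semigroup with an element that is not an identity embeds in the additive
  reals. Excluding anomalous pairs does two things at once. It forces commutativity, because
  for positive \<open>x\<close>, \<open>y\<close> the sums \<open>x + y\<close> and \<open>y + x\<close> have
  multiples so close that they would be an anomalous pair if they differed; and it forces the
  Archimedean property, because adding an infinitesimal to an element would give an anomalous
  pair. One can then measure every element against a fixed positive \<open>a\<close> by a Dedekind
  cut of rational approximations, and the resulting ratio is additive and strictly monotone.

  The terminal object \<open>R\<close> embeds as a set of reals, and it remains to see that no real
  \<open>t\<close> is missed (\<open>terminal_isomorphic_to_reals\<close>). The subgroup of the reals
  generated by the image of \<open>R\<close> and by \<open>t\<close> has no more elements than the infinite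
  set \<open>R\<close>, so a copy of it lives in the universe of the category. The arrow from this copy
  to \<open>R\<close>, followed by the embedding, is a monotone additive map of a subgroup of the
  reals that fixes a nonzero point; such a map is the identity, so \<open>t\<close> is in the image.
  This argument also covers universes of every cardinality, since it takes the existence of a
  terminal object as its starting point and never builds one.

  The group \<open>G\<close> is Archimedean because it is complete, and an Archimedean ordered group
  is non-anomalous, so it embeds as well. Density gives the image arbitrarily small positive
  elements, and then completeness closes all gaps
  (\<open>dense_complete_group_isomorphic_to_reals\<close>).
\<close>

section \<open>Totally ordered semigroups\<close>

locale ordered_semigroup =
  fixes S :: "'a ord_magma" (structure)
  assumes tos: "tot_ord_semigroup S"
begin

abbreviation weak_less :: "'a \<Rightarrow> 'a \<Rightarrow> bool" (infix "\<preceq>" 50) where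
  "x \<preceq> y \<equiv> x \<prec> y \<or> x = y"

abbreviation mul :: "nat \<Rightarrow> 'a \<Rightarrow> 'a" (infixr "\<odot>" 75) where
  "n \<odot> x \<equiv> multiple S n x"

lemma add_closed [simp]: "x \<in> carrier S \<Longrightarrow> y \<in> carrier S \<Longrightarrow> x \<boxplus> y \<in> carrier S"
  using tos by (simp add: tot_ord_semigroup_def)

lemma less_trans:
  "x \<prec> y \<Longrightarrow> y \<prec> z \<Longrightarrow> x \<in> carrier S \<Longrightarrow> y \<in> carrier S \<Longrightarrow> z \<in> carrier S \<Longrightarrow> x \<prec> z"
  using tos unfolding tot_ord_semigroup_def by blast

lemma less_irrefl [simp]: "x \<in> carrier S \<Longrightarrow> \<not> x \<prec> x"
  using tos unfolding tot_ord_semigroup_def by blast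

lemma less_asym: "x \<prec> y \<Longrightarrow> x \<in> carrier S \<Longrightarrow> y \<in> carrier S \<Longrightarrow> \<not> y \<prec> x"
  using tos unfolding tot_ord_semigroup_def by blast

lemma less_linear: "x \<in> carrier S \<Longrightarrow> y \<in> carrier S \<Longrightarrow> x \<prec> y \<or> x = y \<or> y \<prec> x"
  using tos unfolding tot_ord_semigroup_def by blast

lemma add_assoc:
  "x \<in> carrier S \<Longrightarrow> y \<in> carrier S \<Longrightarrow> z \<in> carrier S \<Longrightarrow> (x \<boxplus> y) \<boxplus> z = x \<boxplus> (y \<boxplus> z)"
  using tos unfolding tot_ord_semigroup_def by blast

lemma add_less_right:
  "x \<prec> y \<Longrightarrow> x \<in> carrier S \<Longrightarrow> y \<in> carrier S \<Longrightarrow> z \<in> carrier S \<Longrightarrow> x \<boxplus> z \<prec> y \<boxplus> z"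
  using tos unfolding tot_ord_semigroup_def by blast

lemma add_less_left:
  "x \<prec> y \<Longrightarrow> x \<in> carrier S \<Longrightarrow> y \<in> carrier S \<Longrightarrow> z \<in> carrier S \<Longrightarrow> z \<boxplus> x \<prec> z \<boxplus> y"
  using tos unfolding tot_ord_semigroup_def by blast

lemma add_less_cancel_right [simp]:
  "x \<in> carrier S \<Longrightarrow> y \<in> carrier S \<Longrightarrow> z \<in> carrier S \<Longrightarrow> x \<boxplus> z \<prec> y \<boxplus> z \<longleftrightarrow> x \<prec> y"
  by (metis add_closed add_less_right less_asym less_irrefl less_linear)

lemma add_less_cancel_left [simp]:
  "x \<in> carrier S \<Longrightarrow> y \<in> carrier S \<Longrightarrow> z \<in> carrier S \<Longrightarrow> z \<boxplus> x \<prec> z \<boxplus> y \<longleftrightarrow> x \<prec> y"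
  by (metis add_closed add_less_left less_asym less_irrefl less_linear)

lemma add_cancel_right [simp]:
  "x \<in> carrier S \<Longrightarrow> y \<in> carrier S \<Longrightarrow> z \<in> carrier S \<Longrightarrow> x \<boxplus> z = y \<boxplus> z \<longleftrightarrow> x = y"
  by (metis add_closed add_less_right less_irrefl less_linear)

lemma add_cancel_left [simp]:
  "x \<in> carrier S \<Longrightarrow> y \<in> carrier S \<Longrightarrow> z \<in> carrier S \<Longrightarrow> z \<boxplus> x = z \<boxplus> y \<longleftrightarrow> x = y"
  by (metis add_closed add_less_left less_irrefl less_linear)

lemma weak_less_trans:
  "x \<preceq> y \<Longrightarrow> y \<preceq> z \<Longrightarrow> x \<in> carrier S \<Longrightarrow> y \<in> carrier S \<Longrightarrow> z \<in> carrier S \<Longrightarrow> x \<preceq> z"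
  by (metis less_trans)

lemma add_weak_mono:
  assumes "x \<preceq> y" "u \<preceq> v"
    and "x \<in> carrier S" "y \<in> carrier S" "u \<in> carrier S" "v \<in> carrier S"
  shows "x \<boxplus> u \<preceq> y \<boxplus> v"
proof (rule weak_less_trans)
  show "x \<boxplus> u \<preceq> y \<boxplus> u" "y \<boxplus> u \<preceq> y \<boxplus> v" using assms by simp_all
qed (use assms in simp_all)

lemma mul_one [simp]: "1 \<odot> x = x" "Suc 0 \<odot> x = x"
  by (simp_all add: multiple_def)

lemma mul_Suc: "0 < n \<Longrightarrow> Suc n \<odot> x = n \<odot> x \<boxplus> x"
  by (cases n) (simp_all add: multiple_def)

lemma mul_closed [simp]:
  assumes "x \<in> carrier S"
  shows "n \<odot> x \<in> carrier S"
proof (cases "n = 0")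
  case True
  then show ?thesis using assms by (simp add: multiple_def)
next
  case False
  then have "0 < n" by simp
  then show ?thesis
    by (induction rule: nat_induct_non_zero) (use assms in \<open>auto simp: mul_Suc\<close>)
qed

lemma mul_add:
  assumes x: "x \<in> carrier S" and m: "0 < m" and n: "0 < n"
  shows "(m + n) \<odot> x = m \<odot> x \<boxplus> n \<odot> x"
  using n
proof (induction rule: nat_induct_non_zero)
  case IH: (Suc n)
  then show ?case using x m by (simp add: mul_Suc add_assoc)
qed (use m in \<open>simp add: mul_Suc\<close>)

lemma mul_Suc_left: "x \<in> carrier S \<Longrightarrow> 0 < n \<Longrightarrow> Suc n \<odot> x = x \<boxplus> n \<odot> x"
  using mul_add[of x 1 n] by simp

lemma mul_mul:
  assumes x: "x \<in> carrier S" and m: "0 < m" and n: "0 < n"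
  shows "m \<odot> (n \<odot> x) = (m * n) \<odot> x"
  using m
proof (induction rule: nat_induct_non_zero)
  case IH: (Suc m)
  then show ?case using x n by (simp add: mul_Suc mul_add[symmetric] add.commute)
qed simp

lemma mul_less:
  assumes "x \<prec> y" and xy: "x \<in> carrier S" "y \<in> carrier S" and n: "0 < n"
  shows "n \<odot> x \<prec> n \<odot> y"
  using n
proof (induction rule: nat_induct_non_zero)
  case IH: (Suc n)
  then have "n \<odot> x \<boxplus> x \<prec> n \<odot> y \<boxplus> x" "n \<odot> y \<boxplus> x \<prec> n \<odot> y \<boxplus> y"
    using assms by simp_all
  then have "n \<odot> x \<boxplus> x \<prec> n \<odot> y \<boxplus> y"
    by (rule less_trans) (use xy in simp_all)
  then show ?case using IH by (simp add: mul_Suc)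
qed (use assms in simp)

lemma mul_weak_mono:
  "x \<preceq> y \<Longrightarrow> x \<in> carrier S \<Longrightarrow> y \<in> carrier S \<Longrightarrow> 0 < n \<Longrightarrow> n \<odot> x \<preceq> n \<odot> y"
  using mul_less by blast

text \<open>The inequality \<open>x \<prec> x \<boxplus> x\<close> says that \<open>x\<close> is positive without mentioning an
  identity: cancelling \<open>x\<close> from \<open>y \<boxplus> x \<prec> (y \<boxplus> x) \<boxplus> x\<close> shows that it
  moves every element up.\<close>

lemma add_positive_right:
  assumes "x \<prec> x \<boxplus> x" "x \<in> carrier S" "y \<in> carrier S"
  shows "y \<prec> y \<boxplus> x"
proof -
  have "y \<boxplus> x \<prec> (y \<boxplus> x) \<boxplus> x"
    using assms by (simp add: add_assoc)
  then show ?thesis using assms by simp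
qed

lemma add_positive_left:
  assumes "x \<prec> x \<boxplus> x" "x \<in> carrier S" "y \<in> carrier S"
  shows "y \<prec> x \<boxplus> y"
proof -
  have "x \<boxplus> y \<prec> x \<boxplus> (x \<boxplus> y)"
    using assms by (simp add: add_assoc[symmetric])
  then show ?thesis using assms by simp
qed

text \<open>In the same way an idempotent is a two-sided identity, by cancellation. Every element is
  therefore positive, negative or an identity.\<close>

lemma idempotent_add:
  assumes "x \<boxplus> x = x" "x \<in> carrier S" "y \<in> carrier S"
  shows "y \<boxplus> x = y" "x \<boxplus> y = y"
proof -
  have "(y \<boxplus> x) \<boxplus> x = y \<boxplus> x" "x \<boxplus> (x \<boxplus> y) = x \<boxplus> y"
    using assms add_assoc[of y x x] add_assoc[of x x y] by simp_all
  then show "y \<boxplus> x = y" "x \<boxplus> y = y" using assms by simp_all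
qed

lemma idempotent_is_identity: "x \<boxplus> x = x \<Longrightarrow> x \<in> carrier S \<Longrightarrow> is_identity S x"
  unfolding is_identity_def using idempotent_add by blast

text \<open>Regrouping \<open>(x + y) + \<dots> + (x + y) + x\<close> turns multiples of \<open>x + y\<close> into multiples
  of \<open>y + x\<close> in the absence of commutativity.\<close>

lemma mul_swap:
  assumes "x \<in> carrier S" "y \<in> carrier S" "0 < n"
  shows "n \<odot> (x \<boxplus> y) \<boxplus> x = x \<boxplus> n \<odot> (y \<boxplus> x)"
  using assms(3)
proof (induction rule: nat_induct_non_zero)
  case IH: (Suc n)
  have "n \<odot> (x \<boxplus> y) \<boxplus> (x \<boxplus> y) \<boxplus> x = n \<odot> (x \<boxplus> y) \<boxplus> x \<boxplus> (y \<boxplus> x)"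
    using assms by (simp add: add_assoc)
  also have "\<dots> = x \<boxplus> (n \<odot> (y \<boxplus> x) \<boxplus> (y \<boxplus> x))"
    using IH assms by (simp add: add_assoc)
  finally show ?case using IH by (simp add: mul_Suc)
qed (use assms in \<open>simp add: add_assoc\<close>)

text \<open>By \<open>mul_swap\<close>, \<open>n (x + y) < n (x + y) + x = x + n (y + x) < (n + 1) (y + x)\<close>.\<close>

lemma noncommuting_positives_anomalous:
  assumes "x \<in> carrier S" "y \<in> carrier S" "x \<prec> x \<boxplus> x" "y \<prec> y \<boxplus> y"
    and "y \<boxplus> x \<prec> x \<boxplus> y"
  shows "anomalous_pair S (x \<boxplus> y) (y \<boxplus> x)"
proof -
  have "n \<odot> (x \<boxplus> y) \<prec> (n + 1) \<odot> (y \<boxplus> x)" if n: "1 \<le> n" for n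
  proof -
    have "n \<odot> (x \<boxplus> y) \<prec> n \<odot> (x \<boxplus> y) \<boxplus> x"
      by (rule add_positive_right) (use assms in simp_all)
    also have "n \<odot> (x \<boxplus> y) \<boxplus> x = x \<boxplus> n \<odot> (y \<boxplus> x)"
      using assms n by (intro mul_swap) auto
    finally have 1: "n \<odot> (x \<boxplus> y) \<prec> x \<boxplus> n \<odot> (y \<boxplus> x)" .
    have 2: "x \<boxplus> n \<odot> (y \<boxplus> x) \<prec> (n + 1) \<odot> (y \<boxplus> x)"
      using assms n add_positive_left[of y x] by (simp add: mul_Suc_left)
    show ?thesis by (rule less_trans[OF 1 2]) (use assms in simp_all)
  qed
  then show ?thesis using assms by (auto simp: anomalous_pair_def)
qed

text \<open>If \<open>x + y \<le> y + x\<close>, then sorting the summands of a word in \<open>x\<close> and \<open>y\<close> so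
  that every \<open>x\<close> comes first can only decrease its value, and the sorted word is
  \<open>n x + n y\<close>.\<close>

lemma mul_add_bound_ordered:
  assumes "x \<in> carrier S" "y \<in> carrier S" "x \<boxplus> y \<preceq> y \<boxplus> x" "0 < n"
  shows "n \<odot> x \<boxplus> n \<odot> y \<preceq> n \<odot> (x \<boxplus> y)" "n \<odot> x \<boxplus> n \<odot> y \<preceq> n \<odot> (y \<boxplus> x)"
proof -
  \<comment> \<open>One \<open>x\<close> moves to the left past \<open>n\<close> summands \<open>y\<close>.\<close>
  have swap: "x \<boxplus> n \<odot> y \<preceq> n \<odot> y \<boxplus> x" if "0 < n" for n
    using that
  proof (induction rule: nat_induct_non_zero)
    case IH: (Suc n)
    have 1: "(x \<boxplus> n \<odot> y) \<boxplus> y \<preceq> (n \<odot> y \<boxplus> x) \<boxplus> y"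
      using IH assms by simp
    have 2: "(n \<odot> y \<boxplus> x) \<boxplus> y \<preceq> n \<odot> y \<boxplus> (y \<boxplus> x)"
      using assms by (simp add: add_assoc)
    have "(x \<boxplus> n \<odot> y) \<boxplus> y \<preceq> n \<odot> y \<boxplus> (y \<boxplus> x)"
      by (rule weak_less_trans[OF 1 2]) (use assms in simp_all)
    then show ?case using IH assms(1,2) by (simp add: mul_Suc add_assoc)
  qed (use assms in simp)
  show 1: "n \<odot> x \<boxplus> n \<odot> y \<preceq> n \<odot> (x \<boxplus> y)"
    using assms(4)
  proof (induction rule: nat_induct_non_zero)
    case IH: (Suc n)
    have 1: "n \<odot> x \<boxplus> ((x \<boxplus> n \<odot> y) \<boxplus> y) \<preceq> n \<odot> x \<boxplus> ((n \<odot> y \<boxplus> x) \<boxplus> y)"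
      using swap[OF IH(1)] assms by simp
    have 2: "n \<odot> x \<boxplus> ((n \<odot> y \<boxplus> x) \<boxplus> y) \<preceq> n \<odot> (x \<boxplus> y) \<boxplus> (x \<boxplus> y)"
      using IH assms(1,2) add_weak_mono[of "n \<odot> x \<boxplus> n \<odot> y" "n \<odot> (x \<boxplus> y)" "x \<boxplus> y" "x \<boxplus> y"]
      by (simp add: add_assoc)
    have "n \<odot> x \<boxplus> ((x \<boxplus> n \<odot> y) \<boxplus> y) \<preceq> n \<odot> (x \<boxplus> y) \<boxplus> (x \<boxplus> y)"
      by (rule weak_less_trans[OF 1 2]) (use assms in simp_all)
    then show ?case using IH assms(1,2) by (simp add: mul_Suc add_assoc)
  qed simp
  show "n \<odot> x \<boxplus> n \<odot> y \<preceq> n \<odot> (y \<boxplus> x)"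
    by (rule weak_less_trans[OF 1 mul_weak_mono[OF assms(3)]]) (use assms in simp_all)
qed

text \<open>A substitute for distributivity that suffices for comparing multiples in a group not yet known
  to be commutative: whichever way \<open>x + y\<close> and \<open>y + x\<close> compare, one order of the
  sorted summands is a lower bound.\<close>

lemma mul_add_bound:
  assumes "x \<in> carrier S" "y \<in> carrier S" "0 < n"
  shows "n \<odot> x \<boxplus> n \<odot> y \<preceq> n \<odot> (x \<boxplus> y) \<or> n \<odot> y \<boxplus> n \<odot> x \<preceq> n \<odot> (x \<boxplus> y)"
proof (cases "x \<boxplus> y \<preceq> y \<boxplus> x")
  case True
  from mul_add_bound_ordered(1)[OF assms(1,2) this assms(3)] show ?thesis by (rule disjI1)
next
  case False
  then have "y \<boxplus> x \<preceq> x \<boxplus> y"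
    using less_linear[of "x \<boxplus> y" "y \<boxplus> x"] assms(1,2) add_closed by metis
  from mul_add_bound_ordered(2)[OF assms(2,1) this assms(3)] show ?thesis by (rule disjI2)
qed

end

section \<open>Reversing the order\<close>

text \<open>Reversing the order exchanges positive with negative elements and the two clauses in the
  definition of an anomalous pair, so each fact needs a proof for one sign only.\<close>

definition dual :: "'a ord_magma \<Rightarrow> 'a ord_magma" where
  "dual S = S\<lparr>sless := \<lambda>x y. y \<prec>\<^bsub>S\<^esub> x\<rparr>"

lemma dual_simps [simp]:
  "carrier (dual S) = carrier S" "x \<boxplus>\<^bsub>dual S\<^esub> y = x \<boxplus>\<^bsub>S\<^esub> y"
  "x \<prec>\<^bsub>dual S\<^esub> y \<longleftrightarrow> y \<prec>\<^bsub>S\<^esub> x" "multiple (dual S) n x = multiple S n x"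
  by (simp_all add: dual_def multiple_def)

lemma tot_ord_semigroup_dual:
  assumes "tot_ord_semigroup S"
  shows "tot_ord_semigroup (dual S)"
proof -
  interpret ordered_semigroup S by unfold_locales (rule assms)
  show ?thesis
    unfolding tot_ord_semigroup_def dual_simps
  proof (intro conjI ballI impI)
    fix x y assume "x \<in> carrier S" "y \<in> carrier S"
    then show "(y \<prec>\<^bsub>S\<^esub> x \<and> x \<noteq> y \<and> \<not> x \<prec>\<^bsub>S\<^esub> y) \<or>
        (\<not> y \<prec>\<^bsub>S\<^esub> x \<and> x = y \<and> \<not> x \<prec>\<^bsub>S\<^esub> y) \<or>
        (\<not> y \<prec>\<^bsub>S\<^esub> x \<and> x \<noteq> y \<and> x \<prec>\<^bsub>S\<^esub> y)"
      using less_linear[of x y] less_asym[of x y] by auto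
  qed (auto simp: add_assoc intro: less_trans)
qed

lemma anomalous_pair_dual: "anomalous_pair (dual S) x y \<longleftrightarrow> anomalous_pair S y x"
  by (auto simp: anomalous_pair_def)

lemma nonanomalous_dual: "nonanomalous_semigroup S \<Longrightarrow> nonanomalous_semigroup (dual S)"
  by (auto simp: nonanomalous_semigroup_def tot_ord_semigroup_dual anomalous_pair_dual)

section \<open>Non-anomalous semigroups are commutative\<close>

locale nonanomalous = ordered_semigroup +
  assumes no_anomalous_pair: "\<And>x y. x \<in> carrier S \<Longrightarrow> y \<in> carrier S \<Longrightarrow> \<not> anomalous_pair S x y"
begin

lemma positive_commute:
  assumes "x \<in> carrier S" "y \<in> carrier S" "x \<prec> x \<boxplus> x" "y \<prec> y \<boxplus> y"
  shows "x \<boxplus> y = y \<boxplus> x"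
  using noncommuting_positives_anomalous[of x y] noncommuting_positives_anomalous[of y x] assms no_anomalous_pair
    less_linear[of "x \<boxplus> y" "y \<boxplus> x"] by (metis add_closed)

lemma negative_commute:
  assumes "x \<in> carrier S" "y \<in> carrier S" "x \<boxplus> x \<prec> x" "y \<boxplus> y \<prec> y"
  shows "x \<boxplus> y = y \<boxplus> x"
proof -
  interpret d: nonanomalous "dual S"
    using nonanomalous_dual[of S] tos no_anomalous_pair
    by unfold_locales (auto simp: nonanomalous_semigroup_def)
  show ?thesis by (rule d.positive_commute[unfolded dual_simps]) (use assms in simp_all)
qed

text \<open>For \<open>x\<close> positive and \<open>y\<close> negative, let \<open>p = x + y\<close>. If \<open>p\<close> is positive it
  commutes with \<open>x\<close>, if negative with \<open>y\<close>, and if it is an identity with everything;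
  in each case cancelling the common summand leaves \<open>x + y = y + x\<close>.\<close>

lemma opposite_commute:
  assumes x: "x \<in> carrier S" "x \<prec> x \<boxplus> x" and y: "y \<in> carrier S" "y \<boxplus> y \<prec> y"
  shows "x \<boxplus> y = y \<boxplus> x"
proof -
  define p where "p = x \<boxplus> y"
  have p: "p \<in> carrier S" using x y by (simp add: p_def)
  consider "p \<prec> p \<boxplus> p" | "p \<boxplus> p \<prec> p" | "p \<boxplus> p = p"
    using less_linear p by (metis add_closed)
  then show ?thesis
  proof cases
    case 1
    then have "x \<boxplus> (x \<boxplus> y) = x \<boxplus> (y \<boxplus> x)"
      using positive_commute[of x p] x y p by (simp add: p_def add_assoc)
    then show ?thesis using x y by simp
  next
    case 2
    then have "(x \<boxplus> y) \<boxplus> y = (y \<boxplus> x) \<boxplus> y"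
      using negative_commute[of p y] x y p by (simp add: p_def add_assoc)
    then show ?thesis using x y by (metis add_cancel_right add_closed)
  next
    case 3
    then have "x \<boxplus> (y \<boxplus> x) = x \<boxplus> (x \<boxplus> y)"
      using idempotent_add[of p x] x y p by (simp add: p_def add_assoc)
    then show ?thesis using x y by simp
  qed
qed

lemma add_commute:
  assumes "x \<in> carrier S" "y \<in> carrier S"
  shows "x \<boxplus> y = y \<boxplus> x"
  using positive_commute[of x y] negative_commute[of x y] opposite_commute[of x y]
    opposite_commute[of y x] idempotent_add[of x y] idempotent_add[of y x] assms
    less_linear[of x "x \<boxplus> x"] less_linear[of y "y \<boxplus> y"] by (metis add_closed)

lemma add_left_commute:
  assumes "x \<in> carrier S" "y \<in> carrier S" "z \<in> carrier S"
  shows "x \<boxplus> (y \<boxplus> z) = y \<boxplus> (x \<boxplus> z)"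
  using assms by (simp add: add_assoc[symmetric] add_commute[of x y])

lemmas add_ac = add_assoc add_commute add_left_commute

lemma mul_distrib:
  assumes "x \<in> carrier S" "y \<in> carrier S" "0 < n"
  shows "n \<odot> (x \<boxplus> y) = n \<odot> x \<boxplus> n \<odot> y"
  using assms(3)
proof (induction rule: nat_induct_non_zero)
  case IH: (Suc n)
  then show ?case using assms by (simp add: mul_Suc add_ac)
qed simp

end

section \<open>Measuring against a positive element\<close>

text \<open>A rational of either sign is written as a difference of positive naturals over a positive
  natural, because only positive multiples exist in a semigroup.\<close>

lemma rational_between:
  fixes u v :: real
  assumes "u < v"
  obtains m k n :: nat where "0 < m" "0 < k" "0 < n"
    "u < (real m - real k) / real n" "(real m - real k) / real n < v"
proof -
  obtain q where q: "q \<in> \<rat>" "u < q" "q < v"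
    using Rats_dense_in_real assms by blast
  obtain i :: int and n :: nat where n: "0 < n" "q = of_int i / real n"
    using q(1) by (auto simp: Rats_eq_int_div_nat)
  define m where "m = nat (max i 0) + 1"
  define k where "k = nat (max (- i) 0) + 1"
  have "real m - real k = of_int i"
    by (auto simp: m_def k_def max_def)
  then show thesis using that[of m k n] n q by (simp add: m_def k_def)
qed

locale pointed_positive = nonanomalous +
  fixes a
  assumes a_closed [simp]: "a \<in> carrier S" and a_positive: "a \<prec> a \<boxplus> a"
begin

lemma less_add_a: "x \<in> carrier S \<Longrightarrow> x \<prec> x \<boxplus> a"
  by (simp add: a_positive add_positive_right)

text \<open>If all multiples of \<open>b\<close> stay below \<open>x\<close>, then \<open>b\<close> is infinitesimal with respect to
  \<open>x\<close>, and \<open>n (x + b) = n x + n b < (n + 1) x\<close> for all \<open>n\<close>.\<close>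

lemma archimedean:
  assumes x: "x \<in> carrier S" and b: "b \<in> carrier S" "b \<prec> b \<boxplus> b"
  obtains n where "0 < n" "x \<prec> n \<odot> b"
proof (rule ccontr)
  assume "\<not> thesis"
  then have "0 < n \<Longrightarrow> \<not> x \<prec> n \<odot> b" for n using that by blast
  then have n: "n \<odot> b \<preceq> x" if "0 < n" for n
    using that less_linear[of x "n \<odot> b"] x b by auto
  have less: "n \<odot> b \<prec> x" if "0 < n" for n
  proof -
    have "n \<odot> b \<prec> Suc n \<odot> b"
      using that add_positive_right[of b "n \<odot> b"] b by (simp add: mul_Suc)
    moreover have "Suc n \<odot> b \<prec> x \<or> Suc n \<odot> b = x" using n[of "Suc n"] by simp
    ultimately show ?thesis using less_trans[of "n \<odot> b" "Suc n \<odot> b" x] b x by auto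
  qed
  have "anomalous_pair S (x \<boxplus> b) x"
    unfolding anomalous_pair_def
    using x b less add_positive_right[of b x] by (auto simp: mul_distrib mul_Suc)
  then show False using no_anomalous_pair x b by simp
qed

text \<open>The Archimedean property for elements of any sign, phrased so that it needs neither inverses nor
  an identity. If no \<open>x + k a\<close> is positive, then none is an identity either, since the next
  one would be positive; hence all are negative and
  \<open>(n + 1) (x + a) = n x + (x + (n + 1) a) < n x\<close> for all \<open>n\<close>.\<close>

lemma shift_positive:
  assumes x: "x \<in> carrier S"
  obtains k where "0 < k" "x \<boxplus> k \<odot> a \<prec> (x \<boxplus> k \<odot> a) \<boxplus> (x \<boxplus> k \<odot> a)"
proof (rule ccontr)
  assume "\<not> thesis"
  define z where "z k = x \<boxplus> k \<odot> a" for k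
  have z: "z k \<in> carrier S" for k using x by (simp add: z_def)
  have "0 < k \<Longrightarrow> \<not> z k \<prec> z k \<boxplus> z k" for k
    using \<open>\<not> thesis\<close> that unfolding z_def by blast
  then have n: "z k \<boxplus> z k \<preceq> z k" if "0 < k" for k
    using that less_linear[of "z k" "z k \<boxplus> z k"] z by auto
  have less: "z k \<boxplus> z k \<prec> z k" if "0 < k" for k
  proof (rule ccontr)
    assume "\<not> z k \<boxplus> z k \<prec> z k"
    then have e: "z k \<boxplus> z k = z k" using n[OF that] by simp
    have s: "z (Suc k) = z k \<boxplus> a" using that x by (simp add: z_def mul_Suc add_assoc)
    have "z k \<boxplus> a = a" using idempotent_add(2)[OF e] z by simp
    \<comment> \<open>If \<open>z k\<close> is an identity, then \<open>z (k + 1)\<close> is the positive element \<open>a\<close>.\<close>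
    then show False using n[of "Suc k"] a_positive s less_asym less_irrefl
      by (metis a_closed add_closed zero_less_Suc)
  qed
  have "(n + 1) \<odot> (x \<boxplus> a) \<prec> n \<odot> x" if "1 \<le> n" for n
  proof -
    interpret d: ordered_semigroup "dual S"
      using tos by unfold_locales (rule tot_ord_semigroup_dual)
    have "n \<odot> x \<boxplus> z (n + 1) \<prec> n \<odot> x"
      using d.add_positive_right[of "z (n + 1)" "n \<odot> x"] less[of "n + 1"] z x by simp
    moreover have "(n + 1) \<odot> (x \<boxplus> a) = n \<odot> x \<boxplus> z (n + 1)"
      using that x by (simp add: mul_distrib z_def mul_Suc add_ac)
    ultimately show ?thesis by simp
  qed
  then have "anomalous_pair S (x \<boxplus> a) x"
    unfolding anomalous_pair_def using less_add_a x by simp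
  then show False using no_anomalous_pair x by simp
qed

text \<open>The condition is the inequality \<open>(m - k) / n \<cdot> a \<le> x\<close> with denominators cleared and
  with \<open>k a\<close> moved to the other side, so that negative rationals are covered in a semigroup
  that may have no inverses.\<close>

definition lower_cut :: "'a \<Rightarrow> real set" where
  "lower_cut x = {(real m - real k) / real n | m k n.
     0 < m \<and> 0 < k \<and> 0 < n \<and> m \<odot> a \<preceq> n \<odot> x \<boxplus> k \<odot> a}"

definition ratio :: "'a \<Rightarrow> real" where
  "ratio x = Sup (lower_cut x)"

lemma mul_a_weak_iff:
  assumes "0 < m" "0 < n"
  shows "m \<odot> a \<preceq> n \<odot> a \<longleftrightarrow> m \<le> n"
proof -
  have *: "m \<odot> a \<prec> n \<odot> a" if "0 < m" "m < n" for m n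
  proof -
    have "n \<odot> a = m \<odot> a \<boxplus> (n - m) \<odot> a"
      using mul_add[of a m "n - m"] that by simp
    moreover have "m \<odot> a \<prec> m \<odot> a \<boxplus> (n - m) \<odot> a"
    proof (rule add_positive_right)
      show "(n - m) \<odot> a \<prec> (n - m) \<odot> a \<boxplus> (n - m) \<odot> a"
        using mul_less[OF a_positive, of "n - m"] that by (simp add: mul_distrib)
    qed auto
    ultimately show ?thesis by simp
  qed
  show ?thesis
    using *[of m n] *[of n m] assms less_asym[of "m \<odot> a" "n \<odot> a"]
    by (cases m n rule: linorder_cases) auto
qed

text \<open>Any lower rational approximation of \<open>x\<close> is below any upper one: scale both inequalities to the
  common denominator \<open>n' n\<close>, add them, and cancel the multiple of \<open>x\<close>. The cut of
  \<open>x\<close> therefore determines one real number, which all rational inequalities for \<open>x\<close>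
  respect.\<close>

lemma cut_separation:
  assumes x: "x \<in> carrier S"
    and pos: "0 < m" "0 < k" "0 < n" "0 < m'" "0 < k'" "0 < n'"
    and le: "m \<odot> a \<preceq> n \<odot> x \<boxplus> k \<odot> a"
    and ge: "n' \<odot> x \<boxplus> k' \<odot> a \<preceq> m' \<odot> a"
  shows "(real m - real k) / real n \<le> (real m' - real k') / real n'"
proof -
  have "n' \<odot> (m \<odot> a) \<boxplus> n \<odot> (n' \<odot> x \<boxplus> k' \<odot> a) \<preceq> n' \<odot> (n \<odot> x \<boxplus> k \<odot> a) \<boxplus> n \<odot> (m' \<odot> a)"
    using x pos by (intro add_weak_mono mul_weak_mono le ge) auto
  then have "(n' * n) \<odot> x \<boxplus> ((n' * m) \<odot> a \<boxplus> (n * k') \<odot> a) \<preceq>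
      (n' * n) \<odot> x \<boxplus> ((n' * k) \<odot> a \<boxplus> (n * m') \<odot> a)"
    using x pos by (simp add: mul_distrib mul_mul add_ac mult.commute[of n])
  then have "(n' * m + n * k') \<odot> a \<preceq> (n' * k + n * m') \<odot> a"
    using x pos by (simp add: mul_add)
  then have "n' * m + n * k' \<le> n' * k + n * m'"
    using mul_a_weak_iff pos by simp
  then have "real n' * real m + real n * real k' \<le> real n' * real k + real n * real m'"
    by (metis of_nat_add of_nat_le_iff of_nat_mult)
  then show ?thesis using pos by (simp add: field_simps)
qed

lemma cuts_nonempty:
  assumes x: "x \<in> carrier S"
  shows "\<exists>m k n. 0 < m \<and> 0 < k \<and> 0 < n \<and> m \<odot> a \<preceq> n \<odot> x \<boxplus> k \<odot> a"
    and "\<exists>m k n. 0 < m \<and> 0 < k \<and> 0 < n \<and> n \<odot> x \<boxplus> k \<odot> a \<preceq> m \<odot> a"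
proof -
  obtain k where k: "0 < k" "x \<boxplus> k \<odot> a \<prec> (x \<boxplus> k \<odot> a) \<boxplus> (x \<boxplus> k \<odot> a)"
    using shift_positive[OF x] .
  \<comment> \<open>A positive \<open>x + k a\<close> puts \<open>1 - (k + 1)\<close> into the lower cut.\<close>
  have "a \<prec> (x \<boxplus> k \<odot> a) \<boxplus> a" by (rule add_positive_left) (use k x in simp_all)
  then have "1 \<odot> a \<preceq> 1 \<odot> x \<boxplus> Suc k \<odot> a" using k x by (simp add: mul_Suc add_assoc)
  then show "\<exists>m k n. 0 < m \<and> 0 < k \<and> 0 < n \<and> m \<odot> a \<preceq> n \<odot> x \<boxplus> k \<odot> a"
    by (metis zero_less_Suc zero_less_one)
  obtain m where m: "0 < m" "x \<boxplus> a \<prec> m \<odot> a"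
    using archimedean[of "x \<boxplus> a" a] a_positive x by auto
  then have "1 \<odot> x \<boxplus> 1 \<odot> a \<preceq> m \<odot> a" by simp
  then show "\<exists>m k n. 0 < m \<and> 0 < k \<and> 0 < n \<and> n \<odot> x \<boxplus> k \<odot> a \<preceq> m \<odot> a"
    using m by (metis zero_less_one)
qed

lemma ratio_lower:
  assumes "x \<in> carrier S" "0 < m" "0 < k" "0 < n" "m \<odot> a \<preceq> n \<odot> x \<boxplus> k \<odot> a"
  shows "(real m - real k) / real n \<le> ratio x"
  unfolding ratio_def
proof (rule cSup_upper)
  show "(real m - real k) / real n \<in> lower_cut x"
    using assms unfolding lower_cut_def by blast
  obtain m' k' n' where "0 < m'" "0 < k'" "0 < n'" "n' \<odot> x \<boxplus> k' \<odot> a \<preceq> m' \<odot> a"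
    using cuts_nonempty(2) assms(1) by blast
  then have "q \<le> (real m' - real k') / real n'" if "q \<in> lower_cut x" for q
    using that cut_separation[OF assms(1)] unfolding lower_cut_def by blast
  then show "bdd_above (lower_cut x)" by (rule bdd_aboveI)
qed

lemma ratio_upper:
  assumes "x \<in> carrier S" "0 < m" "0 < k" "0 < n" "n \<odot> x \<boxplus> k \<odot> a \<preceq> m \<odot> a"
  shows "ratio x \<le> (real m - real k) / real n"
  unfolding ratio_def
proof (rule cSup_least)
  show "lower_cut x \<noteq> {}"
    using cuts_nonempty(1)[OF assms(1)] unfolding lower_cut_def by blast
  show "q \<le> (real m - real k) / real n" if q: "q \<in> lower_cut x" for q
  proof -
    obtain m' k' n' where *: "0 < m'" "0 < k'" "0 < n'" "m' \<odot> a \<preceq> n' \<odot> x \<boxplus> k' \<odot> a"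
      and "q = (real m' - real k') / real n'"
      using q unfolding lower_cut_def by blast
    then show ?thesis using cut_separation[OF assms(1) *(1-3) assms(2-4) *(4) assms(5)] by simp
  qed
qed

lemma ratio_lessD:
  assumes "x \<in> carrier S" "0 < m" "0 < k" "0 < n" "ratio x < (real m - real k) / real n"
  shows "n \<odot> x \<boxplus> k \<odot> a \<preceq> m \<odot> a"
  using ratio_lower[OF assms(1-4)] assms less_linear[of "m \<odot> a" "n \<odot> x \<boxplus> k \<odot> a"] by force

lemma ratio_greaterD:
  assumes "x \<in> carrier S" "0 < m" "0 < k" "0 < n" "(real m - real k) / real n < ratio x"
  shows "m \<odot> a \<preceq> n \<odot> x \<boxplus> k \<odot> a"
  using ratio_upper[OF assms(1-4)] assms less_linear[of "m \<odot> a" "n \<odot> x \<boxplus> k \<odot> a"] by force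

text \<open>Two inequalities with denominators \<open>n\<close> and \<open>n'\<close> are added over the common
  denominator \<open>n' n\<close>.\<close>

lemma scaled_sums:
  assumes "x \<in> carrier S" "y \<in> carrier S" "0 < m" "0 < k" "0 < n" "0 < m'" "0 < k'" "0 < n'"
  shows "n' \<odot> (n \<odot> x \<boxplus> k \<odot> a) \<boxplus> n \<odot> (n' \<odot> y \<boxplus> k' \<odot> a) =
      (n' * n) \<odot> (x \<boxplus> y) \<boxplus> (n' * k + n * k') \<odot> a"
    "n' \<odot> (m \<odot> a) \<boxplus> n \<odot> (m' \<odot> a) = (n' * m + n * m') \<odot> a"
  using assms by (simp_all add: mul_distrib mul_mul mul_add add_ac mult.commute[of n])

text \<open>A failure of equality in either direction leaves room for rationals approximating
  \<open>ratio x\<close> and \<open>ratio y\<close> whose sum is on the wrong side of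
  \<open>ratio (x + y)\<close>; adding the corresponding inequalities in the semigroup contradicts this.\<close>

lemma ratio_add:
  assumes x: "x \<in> carrier S" and y: "y \<in> carrier S"
  shows "ratio (x \<boxplus> y) = ratio x + ratio y"
proof (rule antisym; rule ccontr)
  assume "\<not> ratio (x \<boxplus> y) \<le> ratio x + ratio y"
  then have "ratio x < ratio (x \<boxplus> y) - ratio y" by simp
  then obtain m k n where 1: "0 < m" "0 < k" "0 < n" "ratio x < (real m - real k) / real n"
    "(real m - real k) / real n < ratio (x \<boxplus> y) - ratio y"
    by (rule rational_between)
  then have "ratio y < ratio (x \<boxplus> y) - (real m - real k) / real n" by simp
  then obtain m' k' n' where 2: "0 < m'" "0 < k'" "0 < n'" "ratio y < (real m' - real k') / real n'"
    "(real m' - real k') / real n' < ratio (x \<boxplus> y) - (real m - real k) / real n"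
    by (rule rational_between)
  have "n' \<odot> (n \<odot> x \<boxplus> k \<odot> a) \<boxplus> n \<odot> (n' \<odot> y \<boxplus> k' \<odot> a) \<preceq> n' \<odot> (m \<odot> a) \<boxplus> n \<odot> (m' \<odot> a)"
    using x y 1 2 by (intro add_weak_mono mul_weak_mono ratio_lessD) auto
  then have "ratio (x \<boxplus> y) \<le> (real (n' * m + n * m') - real (n' * k + n * k')) / real (n' * n)"
    using 1 2 x y by (intro ratio_upper) (auto simp: scaled_sums)
  also have "\<dots> = (real m - real k) / real n + (real m' - real k') / real n'"
    using 1 2 by (simp add: field_simps)
  finally show False using 2 by simp
next
  assume "\<not> ratio x + ratio y \<le> ratio (x \<boxplus> y)"
  then have "ratio (x \<boxplus> y) - ratio y < ratio x" by simp
  then obtain m k n where 1: "0 < m" "0 < k" "0 < n" "(real m - real k) / real n < ratio x"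
    "ratio (x \<boxplus> y) - ratio y < (real m - real k) / real n"
    by (rule rational_between) blast
  then have "ratio (x \<boxplus> y) - (real m - real k) / real n < ratio y" by simp
  then obtain m' k' n' where 2: "0 < m'" "0 < k'" "0 < n'" "(real m' - real k') / real n' < ratio y"
    "ratio (x \<boxplus> y) - (real m - real k) / real n < (real m' - real k') / real n'"
    by (rule rational_between) blast
  have "n' \<odot> (m \<odot> a) \<boxplus> n \<odot> (m' \<odot> a) \<preceq> n' \<odot> (n \<odot> x \<boxplus> k \<odot> a) \<boxplus> n \<odot> (n' \<odot> y \<boxplus> k' \<odot> a)"
    using x y 1 2 by (intro add_weak_mono mul_weak_mono ratio_greaterD) auto
  then have "(real (n' * m + n * m') - real (n' * k + n * k')) / real (n' * n) \<le> ratio (x \<boxplus> y)"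
    using 1 2 x y by (intro ratio_lower) (auto simp: scaled_sums)
  moreover have "(real (n' * m + n * m') - real (n' * k + n * k')) / real (n' * n)
      = (real m - real k) / real n + (real m' - real k') / real n'"
    using 1 2 by (simp add: field_simps)
  ultimately show False using 2 by simp
qed

lemma ratio_mul:
  assumes x: "x \<in> carrier S" and n: "0 < n"
  shows "ratio (n \<odot> x) = real n * ratio x"
  using n by (induction rule: nat_induct_non_zero)
    (use x in \<open>auto simp: mul_Suc ratio_add algebra_simps\<close>)

lemma ratio_a: "ratio a = 1"
  using ratio_lower[of a 2 1 1] ratio_upper[of a 2 1 1] mul_add[of a 1 1]
  by (simp add: numeral_2_eq_2)

lemma ratio_weak_mono:
  assumes "x \<preceq> y" and x: "x \<in> carrier S" and y: "y \<in> carrier S"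
  shows "ratio x \<le> ratio y"
proof (rule ccontr)
  assume "\<not> ratio x \<le> ratio y"
  then have "ratio y < ratio x" by simp
  then obtain u where u: "ratio y < u" "u < ratio x" using dense by blast
  obtain m k n where 1: "0 < m" "0 < k" "0 < n"
    "ratio y < (real m - real k) / real n" "(real m - real k) / real n < u"
    using rational_between[OF u(1)] .
  have "n \<odot> y \<boxplus> k \<odot> a \<preceq> m \<odot> a" using 1 y by (intro ratio_lessD) auto
  moreover have "n \<odot> x \<boxplus> k \<odot> a \<preceq> n \<odot> y \<boxplus> k \<odot> a"
    using 1 assms by (intro add_weak_mono mul_weak_mono) auto
  ultimately have "n \<odot> x \<boxplus> k \<odot> a \<preceq> m \<odot> a"
    using weak_less_trans x y by (meson a_closed add_closed mul_closed)
  then have "ratio x \<le> (real m - real k) / real n"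
    using 1 x by (intro ratio_upper) auto
  then show False using 1 u by simp
qed

lemma ratio_positive:
  assumes "x \<in> carrier S" "x \<prec> x \<boxplus> x"
  shows "0 < ratio x"
proof -
  obtain n where n: "0 < n" "a \<prec> n \<odot> x"
    using archimedean[of a x] assms by auto
  then have "1 \<le> real n * ratio x"
    using ratio_weak_mono[of a "n \<odot> x"] assms by (simp add: ratio_a ratio_mul)
  then have "0 < real n * ratio x" by linarith
  then show ?thesis using n by (simp add: zero_less_mult_iff)
qed

text \<open>Here the absence of anomalous pairs makes the ratio injective. It gives
  \<open>(n + 1) x \<le> n y\<close> for some \<open>n\<close>, and since \<open>ratio x\<close> is positive, passing
  to ratios yields a strict inequality.\<close>

lemma ratio_less_positive:
  assumes "x \<prec> y" and x: "x \<in> carrier S" "x \<prec> x \<boxplus> x" and y: "y \<in> carrier S"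
  shows "ratio x < ratio y"
proof -
  obtain n where n: "1 \<le> n" "\<not> n \<odot> y \<prec> (n + 1) \<odot> x"
    using no_anomalous_pair[of y x] assms unfolding anomalous_pair_def by blast
  then have "(n + 1) \<odot> x \<preceq> n \<odot> y"
    using less_linear x y by (metis mul_closed)
  then have "real (n + 1) * ratio x \<le> real n * ratio y"
    using ratio_weak_mono[of "(n + 1) \<odot> x" "n \<odot> y"] ratio_mul n x y by simp
  then have "real n * ratio x < real n * ratio y"
    using ratio_positive[OF x] by (simp add: algebra_simps)
  then show ?thesis using n by simp
qed

text \<open>Adding a large multiple of \<open>a\<close> to both elements reduces this to positive elements.\<close>

lemma ratio_less:
  assumes "x \<prec> y" and x: "x \<in> carrier S" and y: "y \<in> carrier S"
  shows "ratio x < ratio y"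
proof -
  obtain k where k: "0 < k" "x \<boxplus> k \<odot> a \<prec> (x \<boxplus> k \<odot> a) \<boxplus> (x \<boxplus> k \<odot> a)"
    using shift_positive[OF x] .
  then have "ratio (x \<boxplus> k \<odot> a) < ratio (y \<boxplus> k \<odot> a)"
    using assms by (intro ratio_less_positive) auto
  then show ?thesis using x y by (simp add: ratio_add)
qed

end

section \<open>Embedding in the reals\<close>

definition reals :: "real ord_magma" where
  "reals = \<lparr>carrier = UNIV, splus = (+), sless = (<)\<rparr>"

lemma reals_simps [simp]:
  "carrier reals = UNIV" "x \<boxplus>\<^bsub>reals\<^esub> y = x + y" "x \<prec>\<^bsub>reals\<^esub> y \<longleftrightarrow> x < y"
  by (simp_all add: reals_def)

theorem nonanomalous_embeds_in_reals:
  assumes S: "nonanomalous_semigroup S" and a: "a \<in> carrier S" "\<not> is_identity S a"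
  shows "\<exists>f. positive_morphism S reals f"
proof -
  have embed: "\<exists>f. positive_morphism T reals f"
    if "nonanomalous_semigroup T" "a \<in> carrier T" "a \<prec>\<^bsub>T\<^esub> a \<boxplus>\<^bsub>T\<^esub> a" for T
  proof -
    interpret pointed_positive T a
      using that by unfold_locales (auto simp: nonanomalous_semigroup_def)
    show ?thesis
      by (rule exI[of _ ratio]) (simp add: positive_morphism_def ratio_add ratio_less)
  qed
  interpret nonanomalous S
    using S by unfold_locales (auto simp: nonanomalous_semigroup_def)
  have "a \<boxplus>\<^bsub>S\<^esub> a \<noteq> a"
    using idempotent_is_identity a by blast
  then consider "a \<prec>\<^bsub>S\<^esub> a \<boxplus>\<^bsub>S\<^esub> a" | "a \<boxplus>\<^bsub>S\<^esub> a \<prec>\<^bsub>S\<^esub> a"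
    using less_linear[of a "a \<boxplus>\<^bsub>S\<^esub> a"] a by auto
  then show ?thesis
  proof cases
    case 1
    then show ?thesis using embed S a by blast
  next
    case 2
    then obtain f where "positive_morphism (dual S) reals f"
      using embed[OF nonanomalous_dual[OF S]] a by auto
    \<comment> \<open>Negation restores the original order.\<close>
    then have "positive_morphism S reals (\<lambda>x. - f x)"
      by (auto simp: positive_morphism_def)
    then show ?thesis by blast
  qed
qed

text \<open>Conversely, whatever embeds in the reals inherits the Archimedean property and so is
  non-anomalous.\<close>

locale real_embedding = ordered_semigroup +
  fixes f
  assumes f: "positive_morphism S reals f"
begin

lemma f_add [simp]: "x \<in> carrier S \<Longrightarrow> y \<in> carrier S \<Longrightarrow> f (x \<boxplus> y) = f x + f y"
  using f by (simp add: positive_morphism_def)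

lemma f_less_iff [simp]: "x \<in> carrier S \<Longrightarrow> y \<in> carrier S \<Longrightarrow> f x < f y \<longleftrightarrow> x \<prec> y"
  using f less_linear[of x y] by (force simp: positive_morphism_def)

lemma f_inj: "inj_on f (carrier S)"
  by (rule inj_onI) (metis f_less_iff less_irrefl less_linear)

lemma f_eq_iff [simp]: "x \<in> carrier S \<Longrightarrow> y \<in> carrier S \<Longrightarrow> f x = f y \<longleftrightarrow> x = y"
  using f_inj by (simp add: inj_on_eq_iff)

lemma f_mul: "0 < n \<Longrightarrow> x \<in> carrier S \<Longrightarrow> f (n \<odot> x) = real n * f x"
  by (induction rule: nat_induct_non_zero) (auto simp: mul_Suc algebra_simps)

lemma f_zero_identity:
  assumes "x \<in> carrier S" "f x = 0"
  shows "is_identity S x"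
proof -
  have "f (x \<boxplus> x) = f x" using assms by simp
  then have "x \<boxplus> x = x" using assms(1) f_eq_iff by (metis add_closed)
  then show ?thesis using idempotent_is_identity assms(1) by blast
qed

text \<open>Either clause of an anomalous pair bounds \<open>n (f x - f y)\<close> for all \<open>n\<close>, by
  \<open>f y\<close> or by \<open>- f x\<close>.\<close>

lemma embedded_nonanomalous: "nonanomalous_semigroup S"
  unfolding nonanomalous_semigroup_def
proof (intro conjI tos notI)
  assume "\<exists>x\<in>carrier S. \<exists>y\<in>carrier S. anomalous_pair S x y"
  then obtain x y where xy: "x \<in> carrier S" "y \<in> carrier S" and a: "anomalous_pair S x y"
    by blast
  have iff: "m \<odot> u \<prec> k \<odot> v \<longleftrightarrow> real m * f u < real k * f v"
    if "0 < m" "0 < k" "u \<in> carrier S" "v \<in> carrier S" for m k u v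
    using that by (simp add: f_mul flip: f_less_iff)
  have *: "(\<forall>n\<ge>1. real n * f x < real (n + 1) * f y) \<or> (\<forall>n\<ge>1. real (n + 1) * f x < real n * f y)"
    using a iff xy unfolding anomalous_pair_def by simp
  have less: "f y < f x" using a xy by (simp add: anomalous_pair_def)
  then obtain n where "\<bar>f x\<bar> + \<bar>f y\<bar> < real n * (f x - f y)"
    using ex_less_of_nat_mult[of "f x - f y"] by auto
  then have "\<bar>f x\<bar> + \<bar>f y\<bar> < real (n + 1) * (f x - f y)"
    using less by (simp add: algebra_simps)
  then show False
    using * by (elim disjE; elim allE[of _ "n + 1"]) (simp_all add: algebra_simps)
qed

end

section \<open>The terminal object is the real line\<close>

text \<open>The semigroup \<open>A\<close> of reals, relabelled along an injection into the universe over which the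
  category is formed.\<close>

definition real_copy :: "(real \<Rightarrow> 'a) \<Rightarrow> real set \<Rightarrow> 'a ord_magma" where
  "real_copy j A = \<lparr>carrier = j ` A,
     splus = \<lambda>u v. j (inv_into A j u + inv_into A j v),
     sless = \<lambda>u v. inv_into A j u < inv_into A j v\<rparr>"

lemma real_copy_nonanomalous:
  assumes j: "inj_on j A" and add: "\<And>x y. x \<in> A \<Longrightarrow> y \<in> A \<Longrightarrow> x + y \<in> A"
  shows "nonanomalous_semigroup (real_copy j A)"
proof -
  have simps [simp]: "carrier (real_copy j A) = j ` A"
    "x \<in> A \<Longrightarrow> y \<in> A \<Longrightarrow> j x \<boxplus>\<^bsub>real_copy j A\<^esub> j y = j (x + y)"
    "x \<in> A \<Longrightarrow> y \<in> A \<Longrightarrow> j x \<prec>\<^bsub>real_copy j A\<^esub> j y \<longleftrightarrow> x < y"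
    "x \<in> A \<Longrightarrow> y \<in> A \<Longrightarrow> j x = j y \<longleftrightarrow> x = y" for x y
    using j by (auto simp: real_copy_def inj_on_eq_iff)
  have "tot_ord_semigroup (real_copy j A)"
    unfolding tot_ord_semigroup_def by (auto simp: add add.assoc)
  then interpret real_embedding "real_copy j A" "inv_into A j"
    by unfold_locales (use j add in \<open>auto simp: positive_morphism_def\<close>)
  show ?thesis by (rule embedded_nonanomalous)
qed

text \<open>The negative sign of \<open>c\<close> is absorbed by the integer \<open>m\<close>; the step from one multiple
  of \<open>c\<close> to the next fits into the gap once \<open>n (v - u)\<close> exceeds \<open>\<bar>c\<bar>\<close>.\<close>

lemma integer_multiple_between:
  fixes c u v :: real
  assumes "c \<noteq> 0" "u < v"
  obtains m :: int and n :: nat where "of_nat n * u < of_int m * c" "of_int m * c < of_nat n * v"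
proof -
  obtain n :: nat where n: "\<bar>c\<bar> < real n * (v - u)"
    using ex_less_of_nat_mult[of "v - u"] assms by auto
  define m where "m = \<lfloor>real n * u / \<bar>c\<bar>\<rfloor> + 1"
  have "real n * u / \<bar>c\<bar> < of_int m" "of_int m \<le> real n * u / \<bar>c\<bar> + 1"
    unfolding m_def by linarith+
  then have "real n * u < of_int m * \<bar>c\<bar>" "of_int m * \<bar>c\<bar> \<le> real n * u + \<bar>c\<bar>"
    using assms by (simp_all add: field_simps)
  then have "real n * u < of_int m * \<bar>c\<bar>" "of_int m * \<bar>c\<bar> < real n * v"
    using n by (simp_all add: algebra_simps)
  then show thesis
    using that[of n m] that[of n "- m"] by (cases "0 \<le> c") auto
qed

text \<open>An order-reversing map is impossible, as it would move \<open>c\<close> to the other side of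
  \<open>h 0 = 0\<close>. An order-preserving one preserves all comparisons between multiples of
  \<open>t\<close> and multiples of the fixed point \<open>c\<close>, and these determine \<open>t\<close>.\<close>

lemma monotone_additive_fixes:
  fixes h :: "real \<Rightarrow> real"
  assumes zero: "0 \<in> A" and add: "\<And>x y. x \<in> A \<Longrightarrow> y \<in> A \<Longrightarrow> x + y \<in> A"
    and minus: "\<And>x. x \<in> A \<Longrightarrow> - x \<in> A"
    and h_add: "\<And>x y. x \<in> A \<Longrightarrow> y \<in> A \<Longrightarrow> h (x + y) = h x + h y"
    and mono: "strict_mono_on A h \<or> strict_antimono_on A h"
    and c: "c \<in> A" "c \<noteq> 0" "h c = c" and t: "t \<in> A"
  shows "h t = t"
proof -
  have h0: "h 0 = 0" using h_add[OF zero zero] by simp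
  have h_minus: "h (- x) = - h x" if "x \<in> A" for x
    using h_add[OF that minus[OF that]] h0 by simp
  have mult: "of_int m * x \<in> A \<and> h (of_int m * x) = of_int m * h x" if x: "x \<in> A" for m :: int and x
  proof (induction m rule: int_induct[where k = 0])
    case base
    then show ?case using zero h0 by simp
  next
    case (step1 i)
    then show ?case using add[of "of_int i * x" x] h_add[of "of_int i * x" x] x
      by (simp add: algebra_simps)
  next
    case (step2 i)
    then show ?case
      using add[of "of_int i * x" "- x"] h_add[of "of_int i * x" "- x"] minus[OF x] h_minus[OF x]
      by (simp add: algebra_simps)
  qed
  have less: "h x < h y" if "x \<in> A" "y \<in> A" "x < y" for x y
  proof -
    have "\<not> strict_antimono_on A h"
      using c zero h0 by (force simp: monotone_on_def not_less_iff_gr_or_eq neq_iff)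
    then show ?thesis using mono that by (auto simp: monotone_on_def)
  qed
  have iff: "h x < h y \<longleftrightarrow> x < y" if "x \<in> A" "y \<in> A" for x y
    using that less[of x y] less[of y x] by (cases x y rule: linorder_cases) auto
  have cmp: "of_int m * c < of_int n * t \<longleftrightarrow> of_int m * c < of_int n * h t"
    "of_int n * t < of_int m * c \<longleftrightarrow> of_int n * h t < of_int m * c" for m n :: int
    using iff[of "of_int m * c" "of_int n * t"] iff[of "of_int n * t" "of_int m * c"]
      mult[OF c(1), of m] mult[OF t, of n] c(3) by simp_all
  show ?thesis
  proof (rule ccontr)
    assume "h t \<noteq> t"
    then consider "h t < t" | "t < h t" by linarith
    then show False
    proof cases
      case 1
      then obtain m :: int and n :: nat where "of_nat n * h t < of_int m * c" "of_int m * c < of_nat n * t"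
        using integer_multiple_between[OF c(2)] by blast
      then show False using cmp(1)[of m "int n"] by simp
    next
      case 2
      then obtain m :: int and n :: nat where "of_nat n * t < of_int m * c" "of_int m * c < of_nat n * h t"
        using integer_multiple_between[OF c(2)] by blast
      then show False using cmp(2)[of "int n" m] by simp
    qed
  qed
qed

unbundle cardinal_syntax

text \<open>The triples index the subgroup of the reals generated by a further real \<open>t\<close> and an additively
  closed set parametrized by \<open>B\<close>: its elements are \<open>f x - f y + n t\<close> with \<open>x\<close>,
  \<open>y\<close> in \<open>B\<close> and \<open>n\<close> an integer.\<close>

lemma card_of_triple_image:
  assumes "infinite B"
  shows "|g ` (B \<times> B \<times> (UNIV :: int set))| \<le>o |B|"
proof -
  have nat: "|UNIV :: nat set| \<le>o |B|" using assms infinite_iff_card_of_nat by blast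
  have "|UNIV :: int set| \<le>o |UNIV :: nat set|"
    using card_of_ordLeq[of "UNIV :: int set" "UNIV :: nat set"] by (metis inj_to_nat subset_UNIV)
  then have int: "|UNIV :: int set| \<le>o |B|" using nat ordLeq_transitive by blast
  have 1: "|B \<times> (UNIV :: int set)| =o |B|"
    using card_of_Times_infinite[OF assms _ int] by simp
  then have "|B \<times> (B \<times> (UNIV :: int set))| =o |B|"
    using card_of_Times_infinite[OF assms _ ordIso_imp_ordLeq[OF 1]] assms by force
  then show ?thesis
    using card_of_image ordIso_imp_ordLeq ordLeq_transitive by blast
qed

text \<open>If \<open>t\<close> were missing from the image, the larger group \<open>A\<close> containing \<open>t\<close> could
  not be squeezed into \<open>R\<close>: the arrow \<open>k\<close> that terminality provides, followed by
  \<open>f\<close>, fixes the point \<open>c\<close> and hence all of \<open>A\<close>.\<close>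

theorem terminal_isomorphic_to_reals:
  fixes R :: "'a ord_magma"
  assumes terminal: "nas_terminal (R, r)"
  shows "\<exists>f. positive_morphism R reals f \<and> bij_betw f (carrier R) UNIV"
proof -
  have R: "nonanomalous_semigroup R" "r \<in> carrier R" "\<not> is_identity R r"
    using terminal by (auto simp: nas_terminal_def nas_obj_def)
  then obtain f where f: "positive_morphism R reals f"
    using nonanomalous_embeds_in_reals[OF R] by blast
  interpret real_embedding R f
    using R(1) f by unfold_locales (simp_all add: nonanomalous_semigroup_def)
  define c where "c = f r"
  have c: "c \<noteq> 0" using f_zero_identity R by (auto simp: c_def)
  \<comment> \<open>The multiples of \<open>r\<close> are distinct; infinity of \<open>R\<close> is what makes room for \<open>A\<close>.\<close>
  have inf: "infinite (carrier R)"
  proof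
    assume "finite (carrier R)"
    then have "finite ((\<lambda>n. f (mul (Suc n) r)) ` UNIV)"
      by (rule finite_subset[rotated, OF finite_imageI[of _ f]]) (use R in auto)
    moreover have "inj (\<lambda>n. f (mul (Suc n) r))"
      using c R by (intro injI) (simp add: f_mul c_def)
    ultimately show False using finite_imageD infinite_UNIV_nat by blast
  qed
  have "t \<in> f ` carrier R" for t
  proof -
    define g where "g = (\<lambda>(x, y, n). f x - f y + of_int n * t)"
    define A where "A = g ` (carrier R \<times> carrier R \<times> (UNIV :: int set))"
    have A: "f x - f y + of_int n * t \<in> A" if "x \<in> carrier R" "y \<in> carrier R" for x y n
      unfolding A_def using that by (auto simp: g_def intro!: image_eqI[of _ _ "(x, y, n)"])
    have A_cases: thesis
      if "z \<in> A" "\<And>x y n. x \<in> carrier R \<Longrightarrow> y \<in> carrier R \<Longrightarrow> z = f x - f y + of_int n * t \<Longrightarrow> thesis"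
      for z thesis
      using that unfolding A_def g_def by auto
    have add: "u + v \<in> A" if uA: "u \<in> A" and vA: "v \<in> A" for u v
    proof -
      obtain x y n where u: "x \<in> carrier R" "y \<in> carrier R" "u = f x - f y + of_int n * t"
        using A_cases[OF uA] .
      obtain x' y' n' where v: "x' \<in> carrier R" "y' \<in> carrier R" "v = f x' - f y' + of_int n' * t"
        using A_cases[OF vA] .
      show ?thesis
        using A[of "x \<boxplus>\<^bsub>R\<^esub> x'" "y \<boxplus>\<^bsub>R\<^esub> y'" "n + n'"] u(1,2) v(1,2)
        unfolding u(3) v(3) by (simp add: algebra_simps)
    qed
    have minus: "- u \<in> A" if uA: "u \<in> A" for u
    proof -
      obtain x y n where u: "x \<in> carrier R" "y \<in> carrier R" "u = f x - f y + of_int n * t"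
        using A_cases[OF uA] .
      show ?thesis using A[of y x "- n"] u(1,2) unfolding u(3) by (simp add: algebra_simps)
    qed
    \<comment> \<open>The point \<open>c = f r\<close> is in \<open>A\<close> as \<open>f (r + r) - f r\<close>.\<close>
    have mem: "0 \<in> A" "t \<in> A" "c \<in> A"
      using A[of r r 0] A[of r r 1] A[of "r \<boxplus>\<^bsub>R\<^esub> r" r 0] R by (simp_all add: c_def)
    have "|A| \<le>o |carrier R|"
      unfolding A_def by (rule card_of_triple_image[OF inf])
    then have "\<exists>j. inj_on j A \<and> j ` A \<subseteq> carrier R" unfolding card_of_ordLeq .
    then obtain j where j: "inj_on j A" "j ` A \<subseteq> carrier R" by blast
    let ?X = "real_copy j A"
    have carrier: "carrier ?X = j ` A" by (simp add: real_copy_def)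
    have plus: "j x \<boxplus>\<^bsub>?X\<^esub> j y = j (x + y)" if "x \<in> A" "y \<in> A" for x y
      using that j by (simp add: real_copy_def)
    have less: "j x \<prec>\<^bsub>?X\<^esub> j y" if "x \<in> A" "y \<in> A" "x < y" for x y
      using that j by (simp add: real_copy_def)
    have "\<not> is_identity ?X (j c)"
    proof
      assume "is_identity ?X (j c)"
      then have "j (c + c) = j c" using mem plus[of c c] by (auto simp: is_identity_def carrier)
      then have "c + c = c" using j(1) mem add by (metis inj_on_eq_iff)
      then show False using c by simp
    qed
    then have "(?X, j c) \<in> nas_obj"
      using real_copy_nonanomalous[OF j(1) add] mem by (auto simp: nas_obj_def carrier)
    then obtain k where k: "k \<in> nas_hom (?X, j c) (R, r)"
      using terminal unfolding nas_terminal_def by blast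
    have k_closed: "k (j x) \<in> carrier R" if "x \<in> A" for x
      using k that by (auto simp: nas_hom_def carrier)
    have "f (k (j t)) = t"
    proof (rule monotone_additive_fixes[where h = "\<lambda>x. f (k (j x))"])
      show "f (k (j (x + y))) = f (k (j x)) + f (k (j y))" if "x \<in> A" "y \<in> A" for x y
      proof -
        have "k (j x \<boxplus>\<^bsub>?X\<^esub> j y) = k (j x) \<boxplus>\<^bsub>R\<^esub> k (j y)"
          using k that by (auto simp: nas_hom_def carrier positive_morphism_def negative_morphism_def)
        then show ?thesis using that k_closed by (simp add: plus)
      qed
      have "positive_morphism ?X R k \<or> negative_morphism ?X R k"
        using k by (simp add: nas_hom_def)
      then show "strict_mono_on A (\<lambda>x. f (k (j x))) \<or> strict_antimono_on A (\<lambda>x. f (k (j x)))"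
      proof
        assume "positive_morphism ?X R k"
        then show ?thesis using less k_closed
          by (auto simp: monotone_on_def positive_morphism_def carrier)
      next
        assume "negative_morphism ?X R k"
        then show ?thesis using less k_closed
          by (auto simp: monotone_on_def negative_morphism_def carrier)
      qed
      show "f (k (j c)) = c" using k by (simp add: nas_hom_def c_def)
    qed (use add minus mem c in auto)
    then show ?thesis using k_closed[OF mem(2)] by (metis imageI)
  qed
  then show ?thesis using f f_inj by (auto simp: bij_betw_def)
qed

section \<open>Complete groups are non-anomalous\<close>

locale ordered_group = ordered_semigroup +
  fixes e
  assumes e_closed [simp]: "e \<in> carrier S"
    and e_left [simp]: "x \<in> carrier S \<Longrightarrow> e \<boxplus> x = x"
    and e_right [simp]: "x \<in> carrier S \<Longrightarrow> x \<boxplus> e = x"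
    and inverse: "x \<in> carrier S \<Longrightarrow> \<exists>i\<in>carrier S. i \<boxplus> x = e \<and> x \<boxplus> i = e"
begin

lemma obtain_inverse:
  assumes "x \<in> carrier S"
  obtains i where "i \<in> carrier S" "i \<boxplus> x = e" "x \<boxplus> i = e"
  using inverse[OF assms] by blast

lemma obtain_difference:
  assumes x: "x \<in> carrier S" and y: "y \<in> carrier S" and "y \<prec> x"
  obtains d where "d \<in> carrier S" "e \<prec> d" "x = d \<boxplus> y"
proof -
  obtain i where i: "i \<in> carrier S" "i \<boxplus> y = e" "y \<boxplus> i = e"
    using obtain_inverse[OF y] .
  have "e \<prec> x \<boxplus> i" using add_less_right[OF assms(3) y x i(1)] unfolding i(3) .
  then show thesis using that[of "x \<boxplus> i"] i assms by (simp add: add_assoc)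
qed

lemma add_positive:
  assumes "e \<prec> d" "d \<in> carrier S" "x \<in> carrier S"
  shows "x \<prec> d \<boxplus> x" "x \<prec> x \<boxplus> d"
  using add_less_right[of e d x] add_less_left[of e d x] assms by simp_all

text \<open>If the multiples of \<open>x\<close> had an upper bound, they would have a supremum \<open>s\<close>; then
  \<open>s - x\<close> is exceeded by some \<open>n x\<close>, and \<open>s\<close> by \<open>(n + 1) x\<close>.\<close>

lemma complete_archimedean:
  assumes complete: "complete_order S"
    and x: "x \<in> carrier S" "e \<prec> x" and y: "y \<in> carrier S"
  obtains n where "0 < n" "y \<prec> n \<odot> x"
proof (rule ccontr)
  assume "\<not> thesis"
  then have no: "0 < n \<Longrightarrow> \<not> y \<prec> n \<odot> x" for n using that by blast
  define U where "U = {n \<odot> x | n. 0 < n}"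
  have "is_upper_bound S U y"
    unfolding is_upper_bound_def
  proof (intro conjI ballI y)
    fix u assume "u \<in> U"
    then obtain n where "0 < n" "u = n \<odot> x" unfolding U_def by blast
    then show "u \<preceq> y" using no[of n] less_linear[of y "n \<odot> x"] x(1) y by auto
  qed
  moreover have "U \<subseteq> carrier S" "U \<noteq> {}" using x by (auto simp: U_def)
  ultimately obtain s where s: "is_upper_bound S U s"
    and least: "\<And>b. is_upper_bound S U b \<Longrightarrow> s \<preceq> b"
    using complete unfolding complete_order_def by blast
  have sc: "s \<in> carrier S" using s by (simp add: is_upper_bound_def)
  obtain i where i: "i \<in> carrier S" "i \<boxplus> x = e" "x \<boxplus> i = e"
    using obtain_inverse[OF x(1)] .
  have sx: "(s \<boxplus> i) \<boxplus> x = s" using i sc x by (simp add: add_assoc)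
  have "s \<boxplus> i \<prec> s" using add_positive(2)[OF x(2) x(1), of "s \<boxplus> i"] sx sc i by simp
  then have "\<not> is_upper_bound S U (s \<boxplus> i)"
    using least[of "s \<boxplus> i"] less_asym[of "s \<boxplus> i" s] sc i by auto
  then obtain n where n: "0 < n" "\<not> n \<odot> x \<preceq> s \<boxplus> i"
    using sc i(1) unfolding is_upper_bound_def U_def by auto
  then have sn: "s \<boxplus> i \<prec> n \<odot> x"
    using less_linear[of "s \<boxplus> i" "n \<odot> x"] sc i(1) x(1) by auto
  then have "s \<prec> Suc n \<odot> x"
    using add_less_right[OF sn, of x] n(1) sc i(1) x(1) unfolding sx by (simp add: mul_Suc)
  moreover have "Suc n \<odot> x \<in> U" by (auto simp: U_def)
  ultimately show False
    using s less_asym[of s "Suc n \<odot> x"] sc x by (auto simp: is_upper_bound_def)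
qed

end

locale archimedean_group = ordered_group +
  assumes arch: "x \<in> carrier S \<Longrightarrow> e \<prec> x \<Longrightarrow> y \<in> carrier S \<Longrightarrow> \<exists>n>0. y \<prec> n \<odot> x"
begin

text \<open>Write \<open>x = d + y\<close> with \<open>d\<close> positive and choose \<open>n\<close> with \<open>n d > y\<close>. By
  \<open>mul_add_bound\<close>, \<open>n x\<close> is at least \<open>n d + n y\<close> or \<open>n y + n d\<close>, and
  both exceed \<open>(n + 1) y\<close>.\<close>

lemma not_anomalous_above:
  assumes x: "x \<in> carrier S" and y: "y \<in> carrier S" and less: "y \<prec> x"
  shows "\<exists>n\<ge>1. \<not> n \<odot> x \<prec> (n + 1) \<odot> y"
proof (cases "e \<prec> y")
  case False
  \<comment> \<open>For \<open>y\<close> not positive already \<open>2 y \<le> y < x\<close>.\<close>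
  then have "y \<preceq> e" using less_linear[of e y] y by auto
  then have "y \<boxplus> y \<preceq> y" using add_weak_mono[of y e y y] y by simp
  then have "y \<boxplus> y \<prec> x" using less less_trans[of "y \<boxplus> y" y x] x y by auto
  then have "\<not> 1 \<odot> x \<prec> (1 + 1) \<odot> y"
    using less_asym[of "y \<boxplus> y" x] x y by (simp add: mul_Suc)
  then show ?thesis by (intro exI[of _ 1]) simp
next
  case True
  obtain d where d: "d \<in> carrier S" "e \<prec> d" "x = d \<boxplus> y"
    using obtain_difference[OF x y less] .
  obtain n where n: "0 < n" "y \<prec> n \<odot> d" using arch[OF d(1,2) y] by blast
  have "(n + 1) \<odot> y \<prec> n \<odot> d \<boxplus> n \<odot> y"
    using n y d by (simp add: mul_Suc_left)
  moreover have "(n + 1) \<odot> y \<prec> n \<odot> y \<boxplus> n \<odot> d"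
    using n y d by (simp add: mul_Suc)
  ultimately have "(n + 1) \<odot> y \<prec> n \<odot> x"
    using mul_add_bound[OF d(1) y n(1)] d(3) d(1) y
      less_trans[of "(n + 1) \<odot> y" "n \<odot> d \<boxplus> n \<odot> y" "n \<odot> x"]
      less_trans[of "(n + 1) \<odot> y" "n \<odot> y \<boxplus> n \<odot> d" "n \<odot> x"] x by auto
  then have "\<not> n \<odot> x \<prec> (n + 1) \<odot> y" using less_asym x y by (meson mul_closed)
  then show ?thesis using n by (intro exI[of _ n]) simp
qed

text \<open>Transfers the Archimedean property to the reversed order by inverses, so that
  \<open>not_anomalous_above\<close> also rules out the second kind of anomalous pair.\<close>

lemma dual_archimedean_group: "archimedean_group (dual S) e"
proof -
  interpret d: ordered_group "dual S" e
    using tot_ord_semigroup_dual[OF tos] inverse by unfold_locales auto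
  show ?thesis
  proof (unfold_locales, unfold dual_simps)
    fix x y assume x: "x \<in> carrier S" "x \<prec> e" and y: "y \<in> carrier S"
    obtain i where i: "i \<in> carrier S" "i \<boxplus> x = e" "x \<boxplus> i = e" using obtain_inverse[OF x(1)] .
    obtain w where w: "w \<in> carrier S" "w \<boxplus> y = e" "y \<boxplus> w = e" using obtain_inverse[OF y] .
    have "e \<prec> i" using add_less_left[OF x(2), of i] x i by simp
    then obtain n where n: "0 < n" "w \<prec> n \<odot> i" using arch[OF i(1) _ w(1)] by blast
    have swap: "n \<odot> x \<boxplus> n \<odot> i = e"
    proof -
      have "n \<odot> (x \<boxplus> i) = e" if "0 < n" for n
        using that by (induction rule: nat_induct_non_zero) (auto simp: mul_Suc i)
      moreover have "n \<odot> x \<boxplus> n \<odot> i = n \<odot> (x \<boxplus> i)"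
        using n(1)
      proof (induction rule: nat_induct_non_zero)
        case IH: (Suc n)
        have "Suc n \<odot> x \<boxplus> Suc n \<odot> i = n \<odot> x \<boxplus> ((x \<boxplus> i) \<boxplus> n \<odot> i)"
          using IH(1) x(1) i(1) by (simp add: mul_Suc[of n x] mul_Suc_left[of i] add_assoc)
        also have "\<dots> = n \<odot> (x \<boxplus> i)" using IH x i by simp
        finally show ?case using IH x i by (simp add: mul_Suc)
      qed simp
      ultimately show ?thesis using n by simp
    qed
    have "e \<prec> n \<odot> i \<boxplus> y" using add_less_right[OF n(2), of y] w y i by simp
    then have "n \<odot> x \<prec> n \<odot> x \<boxplus> (n \<odot> i \<boxplus> y)"
      using add_positive(2) x i y by simp
    also have "\<dots> = (n \<odot> x \<boxplus> n \<odot> i) \<boxplus> y"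
      using x i y add_assoc[of "n \<odot> x" "n \<odot> i" y] by simp
    also have "\<dots> = y" using swap y by simp
    finally show "\<exists>n>0. n \<odot> x \<prec> y" using n by blast
  qed
qed

theorem archimedean_group_nonanomalous: "nonanomalous_semigroup S"
proof -
  interpret d: archimedean_group "dual S" e by (rule dual_archimedean_group)
  show ?thesis
    unfolding nonanomalous_semigroup_def anomalous_pair_def
    using tos not_anomalous_above d.not_anomalous_above[unfolded dual_simps] by blast
qed

end

section \<open>Dense complete groups fill the real line\<close>

locale embedded_group = ordered_group + real_embedding +
  assumes dense: "dense_order S" and complete: "complete_order S"
    and nontrivial: "\<exists>b\<in>carrier S. b \<noteq> e"
begin

lemma f_e [simp]: "f e = 0"
  using f_add[of e e] by simp

lemma f_inverse: "i \<in> carrier S \<Longrightarrow> x \<in> carrier S \<Longrightarrow> i \<boxplus> x = e \<Longrightarrow> f i = - f x"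
  using f_add[of i x] by simp

text \<open>Density splits a positive \<open>x\<close> as \<open>w + z\<close> with both parts positive, and the smaller part
  has at most half the value.\<close>

lemma obtain_half:
  assumes x: "x \<in> carrier S" "0 < f x"
  obtains h where "h \<in> carrier S" "0 < f h" "2 * f h \<le> f x"
proof -
  have "e \<prec> x" using x f_less_iff[of e x] by simp
  then obtain z where z: "z \<in> carrier S" "e \<prec> z" "z \<prec> x"
    using dense x unfolding dense_order_def by (meson e_closed)
  obtain w where w: "w \<in> carrier S" "e \<prec> w" "x = w \<boxplus> z"
    using obtain_difference[OF x(1) z(1,3)] .
  have "0 < f z" "0 < f w" "f x = f w + f z"
    using w z f_less_iff[of e z] f_less_iff[of e w] by simp_all
  then show thesis using that[of z] that[of w] z w by linarith
qed

lemma obtain_small: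
  assumes "0 < \<epsilon>"
  obtains h where "h \<in> carrier S" "0 < f h" "f h < \<epsilon>"
proof -
  obtain b where b: "b \<in> carrier S" "0 < f b"
  proof -
    obtain b where b: "b \<in> carrier S" "b \<noteq> e" using nontrivial by blast
    obtain i where i: "i \<in> carrier S" "i \<boxplus> b = e" using obtain_inverse[OF b(1)] .
    have "f b \<noteq> 0" using b f_eq_iff[of b e] by simp
    then show thesis using that[of b] that[of i] b i f_inverse[of i b] by linarith
  qed
  have "\<exists>h\<in>carrier S. 0 < f h \<and> 2 ^ k * f h \<le> f b" for k
  proof (induction k)
    case (Suc k)
    then obtain h where h: "h \<in> carrier S" "0 < f h" "2 ^ k * f h \<le> f b" by blast
    obtain h' where h': "h' \<in> carrier S" "0 < f h'" "2 * f h' \<le> f h" using obtain_half[OF h(1,2)] .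
    have "2 ^ Suc k * f h' = 2 ^ k * (2 * f h')" by simp
    also have "\<dots> \<le> 2 ^ k * f h" using h' by (intro mult_left_mono) auto
    also have "\<dots> \<le> f b" by (rule h(3))
    finally have "2 ^ Suc k * f h' \<le> f b" .
    then show ?case using h' by blast
  qed (use b in auto)
  moreover obtain k where "f b / \<epsilon> < 2 ^ k" using real_arch_pow[of 2] by auto
  ultimately obtain h where h: "h \<in> carrier S" "0 < f h" "2 ^ k * f h \<le> f b" "f b < 2 ^ k * \<epsilon>"
    using assms by (auto simp: field_simps)
  then have "2 ^ k * f h < 2 ^ k * \<epsilon>" by linarith
  then show thesis using that h by simp
qed

text \<open>The supremum \<open>s\<close> of the elements with value at most \<open>t\<close> has value exactly \<open>t\<close>:
  otherwise a sufficiently small positive \<open>h\<close> could be added to \<open>s\<close> within the set, or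
  subtracted from \<open>s\<close> while leaving an upper bound.\<close>

theorem surjective: "\<exists>s\<in>carrier S. f s = t"
proof -
  define U where "U = {x \<in> carrier S. f x \<le> t}"
  obtain b where b: "b \<in> carrier S" "0 < f b" using obtain_small[of 1] by auto
  obtain i where i: "i \<in> carrier S" "i \<boxplus> b = e" using obtain_inverse[OF b(1)] .
  obtain n where "\<bar>t\<bar> < real n * f b" using ex_less_of_nat_mult[OF b(2)] by blast
  then have n: "0 < n" "\<bar>t\<bar> < f (n \<odot> b)" "f (n \<odot> i) < - \<bar>t\<bar>"
    using b i f_inverse[of i b] by (cases n; simp add: f_mul)+
  have "n \<odot> i \<in> U" using n i by (simp add: U_def)
  moreover have "is_upper_bound S U (n \<odot> b)"
    unfolding is_upper_bound_def
  proof (intro conjI ballI disjI1)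
    fix u assume "u \<in> U"
    then have "u \<in> carrier S" "f u < f (n \<odot> b)" using n by (auto simp: U_def)
    then show "u \<prec> n \<odot> b" using b by simp
  qed (use b in simp)
  moreover have "U \<subseteq> carrier S" by (auto simp: U_def)
  ultimately obtain s where s: "is_upper_bound S U s"
    and least: "\<And>b. is_upper_bound S U b \<Longrightarrow> s \<preceq> b"
    using complete unfolding complete_order_def by blast
  have sc: "s \<in> carrier S" using s by (simp add: is_upper_bound_def)
  have "\<not> f s < t"
  proof
    assume "f s < t"
    then obtain h where h: "h \<in> carrier S" "0 < f h" "f h < t - f s"
      using obtain_small[of "t - f s"] by auto
    then have "s \<boxplus> h \<in> U" using sc by (simp add: U_def)
    then have "f (s \<boxplus> h) \<le> f s"
      using s h sc f_less_iff[of "s \<boxplus> h" s] unfolding is_upper_bound_def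
      by (metis add_closed less_imp_le order_refl)
    then show False using h sc by simp
  qed
  moreover have "\<not> t < f s"
  proof
    assume "t < f s"
    then obtain h where h: "h \<in> carrier S" "0 < f h" "f h < f s - t"
      using obtain_small[of "f s - t"] by auto
    obtain h' where h': "h' \<in> carrier S" "h' \<boxplus> h = e" using obtain_inverse[OF h(1)] .
    have val: "f (s \<boxplus> h') = f s - f h" using sc h h' f_inverse[of h' h] by simp
    have "is_upper_bound S U (s \<boxplus> h')"
      unfolding is_upper_bound_def
    proof (intro conjI ballI disjI1)
      fix u assume "u \<in> U"
      then have "u \<in> carrier S" "f u < f (s \<boxplus> h')" using h val by (auto simp: U_def)
      then show "u \<prec> s \<boxplus> h'" using f_less_iff sc h' by (metis add_closed)
    qed (use sc h' in simp)
    then have "f s \<le> f (s \<boxplus> h')"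
      using least f_less_iff sc h' by (metis add_closed less_imp_le order_refl)
    then show False using h val by simp
  qed
  ultimately show ?thesis using sc by force
qed

end

theorem dense_complete_group_isomorphic_to_reals:
  assumes grp: "tot_ord_group G"
    and nontrivial: "\<exists>x\<in>carrier G. \<exists>y\<in>carrier G. x \<noteq> y"
    and dense: "dense_order G" and complete: "complete_order G"
  shows "\<exists>f. positive_morphism G reals f \<and> bij_betw f (carrier G) UNIV"
proof -
  obtain e where e: "group \<lparr>carrier = carrier G, mult = splus G, one = e\<rparr>"
    and tos: "tot_ord_semigroup G"
    using grp by (auto simp: tot_ord_group_def)
  interpret group "\<lparr>carrier = carrier G, mult = splus G, one = e\<rparr>" by (rule e)
  interpret G: ordered_group G e
  proof unfold_locales
    show "\<exists>i\<in>carrier G. i \<boxplus>\<^bsub>G\<^esub> x = e \<and> x \<boxplus>\<^bsub>G\<^esub> i = e" if "x \<in> carrier G" for x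
      using l_inv[of x] r_inv[of x] inv_closed[of x] that by auto
  qed (use tos one_closed l_one r_one in auto)
  interpret G: archimedean_group G e
    by unfold_locales (metis G.complete_archimedean complete)
  obtain b where b: "b \<in> carrier G" "b \<noteq> e" using nontrivial by metis
  have "\<not> is_identity G b"
    using b G.e_closed G.e_left unfolding is_identity_def by metis
  then obtain f where f: "positive_morphism G reals f"
    using nonanomalous_embeds_in_reals[OF G.archimedean_group_nonanomalous b(1)] by blast
  interpret G: embedded_group G e f
    using f dense complete b by unfold_locales auto
  have "UNIV = f ` carrier G" by (rule UNIV_eq_I) (metis imageI G.surjective)
  then show ?thesis using f G.f_inj by (auto simp: bij_betw_def)
qed

theorem theorem4p5:
  fixes R :: "'a ord_magma" and r :: 'a and G :: "'b ord_magma"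
  assumes terminal: "nas_terminal (R, r)"
    and grp: "tot_ord_group G"
    and nontrivial: "\<exists>x\<in>carrier G. \<exists>y\<in>carrier G. x \<noteq> y"
    and dense: "dense_order G"
    and complete: "complete_order G"
  shows "tos_isomorphic G R"
proof -
  obtain f where f: "positive_morphism R reals f" "bij_betw f (carrier R) UNIV"
    using terminal_isomorphic_to_reals[OF terminal] by blast
  obtain g where g: "positive_morphism G reals g" "bij_betw g (carrier G) UNIV"
    using dense_complete_group_isomorphic_to_reals[OF grp nontrivial dense complete] by blast
  have "tot_ord_semigroup R"
    using terminal by (auto simp: nas_terminal_def nas_obj_def nonanomalous_semigroup_def)
  then interpret R: real_embedding R f
    using f by unfold_locales auto
  let ?h = "inv_into (carrier R) f"
  have h: "?h t \<in> carrier R" "f (?h t) = t" for t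
    using f(2) by (auto simp: bij_betw_def inv_into_into f_inv_into_f)
  have h_unique: "?h t = x" if "x \<in> carrier R" "f x = t" for x t
    using that h[of t] R.f_eq_iff by metis
  have "positive_morphism G R (?h \<circ> g)"
    unfolding positive_morphism_def
  proof (intro conjI ballI impI)
    fix x y assume xy: "x \<in> carrier G" "y \<in> carrier G"
    show "(?h \<circ> g) (x \<boxplus>\<^bsub>G\<^esub> y) = (?h \<circ> g) x \<boxplus>\<^bsub>R\<^esub> (?h \<circ> g) y"
      using g(1) xy h by (auto simp: positive_morphism_def intro!: h_unique)
    assume "x \<prec>\<^bsub>G\<^esub> y"
    then have "f (?h (g x)) < f (?h (g y))"
      using g(1) xy h by (simp add: positive_morphism_def)
    then show "(?h \<circ> g) x \<prec>\<^bsub>R\<^esub> (?h \<circ> g) y"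
      using h(1) R.f_less_iff by simp
  qed (use h in auto)
  moreover have "bij_betw (?h \<circ> g) (carrier G) (carrier R)"
    using g(2) bij_betw_inv_into[OF f(2)] by (rule bij_betw_trans)
  ultimately show ?thesis unfolding tos_isomorphic_def by blast
qed

end
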